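(* For every integer $n\ge 2$ and every even integer $s\ge 2$, $\operatorname{Ssat}(u_s,n)\le \left(\frac{s+2}{2}\right)n$.
   Context: Sequences are finite words over an alphabet; a sequence on a given alphabet takes its letters from that alphabet (not every letter is required to appear). Two sequences are isomorphic if one is obtained from the other by a one-to-one renaming of letters. A copy of $u$ in a sequence is a (not necessarily contiguous) subsequence isomorphic to $u$. A sequence is $2$-sparse if no two adjacent letters are equal. For an integer $s\ge 0$, $u_s=xyxy\dots$ is the alternating sequence on two distinct letters $x,y$ of length $s+2$. A sequence on a given alphabet is $u_s$-semisaturated if it is $2$-sparse and inserting any letter of the alphabet at any position (including the beginning or the end) violates $2$-sparsity or creates a new copy of $u_s$, i.e. a copy that uses the inserted occurrence; the sequence itself need not avoid $u_s$. $\operatorname{Ssat}(u_s,n)$ is the minimum possible length of a $u_s$-semisaturated sequence on an alphabet of size $n$. *)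

theory Defs
  imports Main "HOL-Library.Extended_Nat"
begin

definition isomorphic_seq :: "'a list \<Rightarrow> 'b list \<Rightarrow> bool" where
  "isomorphic_seq u v \<longleftrightarrow> (\<exists>f. inj_on f (set u) \<and> v = map f u)"

text \<open>A copy is recorded by the set of positions it occupies, so that one can say which
  occurrences it uses.\<close>

definition copy_at :: "'a list \<Rightarrow> 'b list \<Rightarrow> nat set \<Rightarrow> bool" where
  "copy_at u w I \<longleftrightarrow> I \<subseteq> {..<length w} \<and> isomorphic_seq u (nths w I)"

definition insert_at :: "nat \<Rightarrow> 'a \<Rightarrow> 'a list \<Rightarrow> 'a list" where
  "insert_at i a w = take i w @ a # drop i w"

definition alternating :: "nat \<Rightarrow> nat list" where
  "alternating s = map (\<lambda>i. if even i then 0 else 1) [0..<s + 2]"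

text \<open>Here \<open>distinct_adj\<close> is 2-sparsity. The inserted letter sits at position \<open>i\<close> of the new
  sequence, so a new copy is one whose positions include \<open>i\<close>; the sequence itself may
  contain copies of \<open>u\<close>.\<close>

definition semisaturated :: "'b list \<Rightarrow> 'a set \<Rightarrow> 'a list \<Rightarrow> bool" where
  "semisaturated u A w \<longleftrightarrow> set w \<subseteq> A \<and> distinct_adj w \<and>
     (\<forall>a\<in>A. \<forall>i\<le>length w.
        \<not> distinct_adj (insert_at i a w) \<or> (\<exists>I. i \<in> I \<and> copy_at u (insert_at i a w) I))"

text \<open>The alphabet of size \<open>n\<close> is taken to be \<open>{..<n}\<close>. The value lies in \<open>enat\<close>, where the
  infimum of a nonempty set is its minimum and that of the empty set is \<open>\<infinity>\<close>; thus a finite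
  upper bound entails that a semisaturated sequence exists.\<close>

definition Ssat :: "'b list \<Rightarrow> nat \<Rightarrow> enat" where
  "Ssat u n = (INF w \<in> {w :: nat list. semisaturated u {..<n} w}. enat (length w))"

end

theory Submission
  imports Defs "HOL-Library.Sublist"
begin

text \<open>Put \<open>m = (s + 2) div 2\<close>. The witness is the word \<open>0 1 \<dots> (n-1)\<close> repeated \<open>m\<close> times.
  It is 2-sparse and has length \<open>m * n\<close>. For any two letters \<open>x < y\<close>, deleting all other
  letters leaves \<open>(x y)\<^sup>m\<close>, an alternation of length \<open>2 * m = s + 2\<close>, hence already a copy of
  \<open>u\<^sub>s\<close>.

  Insert a letter \<open>a\<close> anywhere, take any other letter \<open>b\<close>, and delete all letters except
  \<open>a\<close> and \<open>b\<close>. If the inserted \<open>a\<close> is now next to an old \<open>a\<close>, it can replace that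
  occurrence in the copy. Otherwise it stands next to \<open>b\<close> at one end of the alternation
  and prolongs it, so that dropping the letter at the opposite end leaves an alternation of the
  right length. In both cases there is a copy through the inserted occurrence; this is
  \<open>insertion_into_alternation\<close>, and \<open>copy_at_insertI\<close> pulls it back to the full word.\<close>

definition alternation :: "'a \<Rightarrow> 'a \<Rightarrow> nat \<Rightarrow> 'a list" where
  "alternation x y l = map (\<lambda>i. if even i then x else y) [0..<l]"

lemma length_alternation [simp]: "length (alternation x y l) = l"
  by (simp add: alternation_def)

lemma nth_alternation [simp]:
  "i < l \<Longrightarrow> alternation x y l ! i = (if even i then x else y)"
  by (simp add: alternation_def)

lemma isomorphic_alternation:
  assumes "x \<noteq> y"
  shows "isomorphic_seq (alternating s) (alternation x y (s + 2))"
  unfolding isomorphic_seq_def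
proof (intro exI conjI)
  show "inj_on (\<lambda>k. if k = 0 then x else y) (set (alternating s))"
    using assms by (auto simp: inj_on_def alternating_def)
  show "alternation x y (s + 2) = map (\<lambda>k. if k = 0 then x else y) (alternating s)"
    by (simp add: alternation_def alternating_def)
qed

lemma concat_replicate_pair:
  "concat (replicate m [x, y]) = alternation x y (2 * m)"
proof (induction m)
  case (Suc m)
  have "alternation x y (2 * Suc m) = x # y # alternation x y (2 * m)"
    by (rule nth_equalityI) (auto simp: nth_Cons split: nat.split)
  with Suc show ?case by simp
qed (simp add: alternation_def)

text \<open>Splitting the target word at the inserted letter turns the search for a set of positions
  into two independent subsequence problems.\<close>

lemma copy_at_insertI:
  assumes "isomorphic_seq u (xs @ a # ys)"
    and "subseq xs (take i w)" and "subseq ys (drop i w)" and "i \<le> length w"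
  shows "\<exists>I. i \<in> I \<and> copy_at u (insert_at i a w) I"
proof -
  obtain M where M: "xs = nths (take i w) M"
    using assms(2) by (auto simp: subseq_conv_nths)
  obtain N where N: "ys = nths (drop i w) N"
    using assms(3) by (auto simp: subseq_conv_nths)
  define I where "I = (M \<inter> {..<i}) \<union> {i} \<union> ((+) (Suc i) ` (N \<inter> {..<length w - i}))"
  have left: "nths (take i w) I = nths (take i w) M"
    unfolding nths_def
    by (rule arg_cong[where f = "map fst"], rule filter_cong)
       (auto simp: I_def set_zip)
  have right: "nths (drop i w) {j. Suc (j + i) \<in> I} = nths (drop i w) N"
    unfolding nths_def
    by (rule arg_cong[where f = "map fst"], rule filter_cong)
       (auto simp: I_def set_zip)
  have "nths (insert_at i a w) I = xs @ a # ys"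
    using left right assms(4)
    by (simp add: insert_at_def nths_append nths_Cons M N min_def) (simp add: I_def)
  moreover have "I \<subseteq> {..<length (insert_at i a w)}"
    using assms(4) by (force simp: I_def insert_at_def)
  ultimately show ?thesis
    using assms(1) by (intro exI[of _ I]) (simp add: copy_at_def, simp add: I_def)
qed

text \<open>An insertion that merely prolongs the alternation at one end is paid for by dropping the
  letter at the other end, which exchanges the roles of the two letters; this is why both
  orders appear in the conclusion.\<close>

lemma insertion_into_alternation:
  assumes "l > 0" and "j \<le> l" and "a = x \<or> a = y"
  shows "\<exists>xs ys. subseq xs (take j (alternation x y l)) \<and> subseq ys (drop j (alternation x y l))
           \<and> (xs @ a # ys = alternation x y l \<or> xs @ a # ys = alternation y x l)"
proof -
  let ?v = "alternation x y l"
  consider (right) "j < l" "?v ! j = a" | (left) "0 < j" "?v ! (j - 1) = a"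
    | (at_start) "j = 0" "a = y" | (at_end) "j = l" "a = (if even l then x else y)"
    using assms by (cases "even j"; cases "j = 0"; cases "j = l") auto
  then show ?thesis
  proof cases
    case right
    then have "take j ?v @ a # drop (Suc j) ?v = ?v"
      using id_take_nth_drop[of j ?v] by (simp del: nth_alternation)
    moreover have "subseq (drop (Suc j) ?v) (drop j ?v)"
      using right by (metis Cons_nth_drop_Suc length_alternation list_emb_Cons subseq_order.refl)
    ultimately show ?thesis by blast
  next
    case left
    then have "take (j - 1) ?v @ a # drop j ?v = ?v"
      using id_take_nth_drop[of "j - 1" ?v] assms(2) by (simp del: nth_alternation)
    moreover have "subseq (take (j - 1) ?v) (take j ?v)"
      by (metis diff_le_self prefix_imp_subseq take_is_prefix min.absorb1 take_take)
    ultimately show ?thesis by blast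
  next
    case at_start
    have "a # take (l - 1) ?v = alternation y x l"
      using assms at_start by (intro nth_equalityI) (auto simp: nth_Cons split: nat.split)
    moreover have "subseq (take (l - 1) ?v) (drop j ?v)"
      using at_start by (simp add: prefix_imp_subseq take_is_prefix)
    ultimately show ?thesis
      by (intro exI[of _ "[]"] exI[of _ "take (l - 1) ?v"]) simp
  next
    case at_end
    have "even i \<longleftrightarrow> odd l" if "i < l" "\<not> i < l - 1" for i
      using that by presburger
    then have "drop 1 ?v @ [a] = alternation y x l"
      using assms at_end by (intro nth_equalityI) (auto simp: nth_append)
    moreover have "subseq (drop 1 ?v) (take j ?v)"
      using at_end by (simp add: suffix_imp_subseq suffix_drop)
    ultimately show ?thesis
      by (intro exI[of _ "drop 1 ?v"] exI[of _ "[]"]) simp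
  qed
qed

lemma filter_pair_upt:
  assumes "x < y" and "y < n"
  shows "filter (\<lambda>c. c = x \<or> c = y) [0..<n] = [x, y]"
  by (rule sorted_distinct_set_unique) (use assms in \<open>auto intro: sorted_wrt_filter\<close>)

lemma distinct_adj_concat_replicate_upt:
  assumes "n \<ge> 2"
  shows "distinct_adj (concat (replicate m [0..<n]))"
proof (induction m)
  case (Suc m)
  have "hd (concat (replicate m [0..<n])) = 0" if "m > 0"
    using that assms by (cases m) (auto simp: hd_append)
  moreover have "distinct_adj [0..<n]"
    by (simp add: distinct_adj_conv_nth)
  ultimately show ?case
    using Suc assms by (cases "m = 0") (auto simp: distinct_adj_append_iff)
qed simp

lemma insertion_creates_copy:
  assumes "x < y" and "y < n" and "a = x \<or> a = y" and "s + 2 = 2 * m"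
    and "i \<le> length (concat (replicate m [0..<n]))"
  shows "\<exists>I. i \<in> I \<and> copy_at (alternating s) (insert_at i a (concat (replicate m [0..<n]))) I"
proof -
  let ?w = "concat (replicate m [0..<n])" and ?v = "alternation x y (s + 2)"
  let ?F = "filter (\<lambda>c. c = x \<or> c = y)"
  have "?F ?w = ?v"
    using assms by (simp add: filter_concat filter_pair_upt concat_replicate_pair)
  then have split: "?F (take i ?w) @ ?F (drop i ?w) = ?v"
    by (metis append_take_drop_id filter_append)
  \<comment> \<open>The gap of the alternation into which the inserted letter falls.\<close>
  define j where "j = length (?F (take i ?w))"
  have take_j: "take j ?v = ?F (take i ?w)" and drop_j: "drop j ?v = ?F (drop i ?w)"
    unfolding split[symmetric] by (simp_all add: j_def)
  have "j \<le> s + 2"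
    using arg_cong[OF split, of length] by (simp add: j_def)
  then obtain xs ys where sub: "subseq xs (take j ?v)" "subseq ys (drop j ?v)"
      and eq: "xs @ a # ys = ?v \<or> xs @ a # ys = alternation y x (s + 2)"
    using insertion_into_alternation[of "s + 2" j a x y] assms(3) by auto
  have "isomorphic_seq (alternating s) (xs @ a # ys)"
    using eq isomorphic_alternation[of x y s] isomorphic_alternation[of y x s] assms(1) by auto
  moreover have "subseq xs (take i ?w)" "subseq ys (drop i ?w)"
    using sub unfolding take_j drop_j by (meson subseq_filter_left subseq_order.trans)+
  ultimately show ?thesis
    using assms(5) by (intro copy_at_insertI)
qed

lemma semisaturated_concat_replicate_upt:
  assumes "n \<ge> 2" and "s + 2 = 2 * m"
  shows "semisaturated (alternating s) {..<n} (concat (replicate m [0..<n]))"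
  unfolding semisaturated_def
proof (intro conjI ballI allI impI disjI2)
  fix a i assume a: "a \<in> {..<n}" and i: "i \<le> length (concat (replicate m [0..<n]))"
  obtain x y where "x < y" "y < n" "a = x \<or> a = y"
  proof (cases "a = 0")
    case True
    then show ?thesis using that[of 0 1] assms(1) by simp
  next
    case False
    then show ?thesis using that[of 0 a] a by simp
  qed
  then show "\<exists>I. i \<in> I \<and> copy_at (alternating s) (insert_at i a (concat (replicate m [0..<n]))) I"
    using assms(2) i by (rule insertion_creates_copy)
next
  show "distinct_adj (concat (replicate m [0..<n]))"
    using assms(1) by (rule distinct_adj_concat_replicate_upt)
qed auto

theorem lemma4p8:
  fixes n s :: nat
  assumes "n \<ge> 2" and "s \<ge> 2" and "even s"
  shows "Ssat (alternating s) n \<le> enat ((s + 2) div 2 * n)"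
proof -
  let ?w = "concat (replicate ((s + 2) div 2) [0..<n])"
  have "semisaturated (alternating s) {..<n} ?w"
    using assms by (intro semisaturated_concat_replicate_upt) auto
  then have "Ssat (alternating s) n \<le> enat (length ?w)"
    unfolding Ssat_def by (intro INF_lower) simp
  then show ?thesis
    by (simp add: length_concat sum_list_replicate)
qed

end
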